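(* Let $f,g:\mathbb{R}^d\to\mathbb{R}$ be differentiable, convex and $G$-Lipschitz ($G>0$), and let $w^\ast$ be a solution of $\min_{w\in\mathbb{R}^d} f(w)$ subject to $g(w)\le 0$. Let $T\ge 1$ be an integer, $w_1\in\mathbb{R}^d$, $D:=\|w_1-w^\ast\|$, and let the iterates be generated by the soft switching gradient method $$w_{t+1}=w_t-\eta F(w_t),\qquad F(w)=\sigma_\beta(g(w)-\epsilon)\nabla g(w)+[1-\sigma_\beta(g(w)-\epsilon)]\nabla f(w),$$ where $\sigma_\beta(x)=\min\{1,\max\{0,1+\beta x\}\}$. Define $$\mathcal{A}=\{t\in\{1,\dots,T\} : g(w_t)<\epsilon\},\qquad \bar w=\sum_{t\in\mathcal{A}}\alpha_t w_t,\qquad \alpha_t=\frac{1-\sigma_\beta(g(w_t)-\epsilon)}{\sum_{s\in\mathcal{A}}[1-\sigma_\beta(g(w_s)-\epsilon)]}.$$ If $$\epsilon=\frac{2DG}{\sqrt{T}},\qquad \eta=\frac{D}{G\sqrt{T}},\qquad \beta=\frac{2}{\epsilon},$$ then $\mathcal{A}$ is nonempty, $\bar w$ is well-defined, and $\bar w$ is an $\epsilon$-solution, i.e. $f(\bar w)-f(w^\ast)\le\epsilon$ and $g(\bar w)\le\epsilon$.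
   Context: $\|\cdot\|$ is the Euclidean norm. The tolerance satisfies $\epsilon>0$ (so $\beta=2/\epsilon$ is defined). A function $f$ is $G$-Lipschitz if $|f(x)-f(y)|\le G\|x-y\|$ for all $x,y$ (for differentiable $f$, equivalently $\|\nabla f(x)\|\le G$ for all $x$). *)

theory Defs
  imports "HOL-Analysis.Analysis"
begin

definition gradient :: "('a::euclidean_space \<Rightarrow> real) \<Rightarrow> 'a \<Rightarrow> 'a" where
  "gradient f x = (THE D. GDERIV f x :> D)"

(* The description is proper wherever f is differentiable. *)
lemma GDERIV_gradient:
  fixes f :: "'a::euclidean_space \<Rightarrow> real"
  assumes "f differentiable (at x)"
  shows "GDERIV f x :> gradient f x"
proof -
  obtain f' where f': "(f has_derivative f') (at x)"
    using assms by (auto simp: differentiable_def)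
  then have lin: "linear f'"
    by (rule has_derivative_linear)
  have "f' = (\<lambda>h. inner h (adjoint f' 1))"
    using adjoint_works[OF lin, of _ 1] by (auto simp: fun_eq_iff inner_real_def)
  with f' have ex: "GDERIV f x :> adjoint f' 1"
    by (simp add: gderiv_def)
  have uniq: "D = E" if "GDERIV f x :> D" "GDERIV f x :> E" for D E
  proof -
    have "(\<lambda>h. inner h D) = (\<lambda>h. inner h E)"
      using has_derivative_unique that unfolding gderiv_def by blast
    then show ?thesis
      by (metis inner_commute vector_eq_rdot)
  qed
  show ?thesis
    unfolding gradient_def using ex by (rule theI) (rule uniq[OF _ ex])
qed

definition soft_switch :: "real \<Rightarrow> real \<Rightarrow> real" where
  "soft_switch \<beta> x = min 1 (max 0 (1 + \<beta> * x))"

definition switching_direction ::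
  "real \<Rightarrow> real \<Rightarrow> ('a::euclidean_space \<Rightarrow> real) \<Rightarrow> ('a \<Rightarrow> real) \<Rightarrow> 'a \<Rightarrow> 'a" where
  "switching_direction \<beta> \<epsilon> f g w =
     soft_switch \<beta> (g w - \<epsilon>) *\<^sub>R gradient g w
     + (1 - soft_switch \<beta> (g w - \<epsilon>)) *\<^sub>R gradient f w"

end

theory Submission
  imports Defs
begin

text \<open>Expanding the square of the distance to the optimum bounds the sum of
the inner products of the step directions with the vectors from the optimum to the
iterates by \<open>\<epsilon> T / 2\<close>. By convexity, each summand is at least
\<open>s\<^sub>t g(w\<^sub>t) + (1 - s\<^sub>t) (f(w\<^sub>t) - f(w\<^sup>*))\<close>, where \<open>s\<^sub>t\<close> is the switching weight, and
\<open>\<beta> = 2/\<epsilon>\<close> makes \<open>s\<^sub>t\<close> vanish unless \<open>g(w\<^sub>t) > \<epsilon>/2\<close>. Hence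
the \<open>(1 - s\<^sub>t)\<close>-weighted average of \<open>f(w\<^sub>t) - f(w\<^sup>*)\<close> is at most \<open>\<epsilon>/2\<close>,
and Jensen's inequality transfers both bounds to the averaged iterate.\<close>

section \<open>Gradient inequalities and the energy estimate for descent steps\<close>

lemma GDERIV_line:
  fixes f :: "'a::real_inner \<Rightarrow> real"
  assumes "GDERIV f x :> D"
  shows "((\<lambda>t. f (x + t *\<^sub>R v)) has_real_derivative inner v D) (at 0)"
proof -
  have f: "(f has_derivative (\<lambda>h. inner h D)) (at (x + 0 *\<^sub>R v))"
    using assms by (simp add: gderiv_def)
  have l: "((\<lambda>t. x + t *\<^sub>R v) has_derivative (\<lambda>t. t *\<^sub>R v)) (at 0)"
    by (auto intro!: derivative_eq_intros)
  show ?thesis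
    using has_derivative_compose[OF l f]
    by (simp add: has_field_derivative_def inner_scaleR_left mult_commute_abs)
qed

text \<open>Restricting \<open>f\<close> to the line from \<open>x\<close> to \<open>y\<close>
  reduces the claim to the tangent inequality for a convex function of one real variable.\<close>

lemma convex_on_above_gradient:
  fixes f :: "'a::real_inner \<Rightarrow> real"
  assumes f: "convex_on UNIV f" and D: "GDERIV f x :> D"
  shows "f x + inner (y - x) D \<le> f y"
proof -
  define p where "p t = f (x + t *\<^sub>R (y - x))" for t
  have "convex_on UNIV p"
  proof (rule convex_onI)
    fix t a b :: real
    assume t: "0 < t" "t < 1"
    have "x + ((1 - t) * a + t * b) *\<^sub>R (y - x) =
      (1 - t) *\<^sub>R (x + a *\<^sub>R (y - x)) + t *\<^sub>R (x + b *\<^sub>R (y - x))"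
      by (simp add: algebra_simps)
    then show "p ((1 - t) *\<^sub>R a + t *\<^sub>R b) \<le> (1 - t) * p a + t * p b"
      using convex_onD[OF f, of t "x + a *\<^sub>R (y - x)" "x + b *\<^sub>R (y - x)"] t
      by (simp add: p_def)
  qed simp
  moreover have "(p has_real_derivative inner (y - x) D) (at 0)"
    unfolding p_def by (rule GDERIV_line[OF D])
  ultimately have "inner (y - x) D * (1 - 0) \<le> p 1 - p 0"
    by (intro convex_on_imp_above_tangent) auto
  then show ?thesis
    by (simp add: p_def)
qed

text \<open>Along the direction \<open>D\<close> itself the directional derivative is the square of
  \<open>norm D\<close>, whereas the Lipschitz condition caps the difference quotients by
  \<open>G * norm D\<close>.\<close>

lemma lipschitz_on_norm_gradient_le:
  fixes f :: "'a::real_inner \<Rightarrow> real"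
  assumes f: "G-lipschitz_on UNIV f" and D: "GDERIV f x :> D"
  shows "norm D \<le> G"
proof (cases "D = 0")
  case True
  then show ?thesis
    using lipschitz_on_nonneg[OF f] by simp
next
  case False
  have lim: "((\<lambda>t. (f (x + t *\<^sub>R D) - f x) / t) \<longlongrightarrow> inner D D) (at 0)"
    using GDERIV_line[OF D, of D] by (simp add: DERIV_def)
  have "(f (x + t *\<^sub>R D) - f x) / t \<le> G * norm D" if "t \<noteq> 0" for t
  proof -
    have "\<bar>f (x + t *\<^sub>R D) - f x\<bar> \<le> G * (\<bar>t\<bar> * norm D)"
      using lipschitz_onD[OF f, of "x + t *\<^sub>R D" x] by (simp add: dist_norm)
    then have "\<bar>(f (x + t *\<^sub>R D) - f x) / t\<bar> \<le> G * norm D"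
      using that by (simp add: abs_divide divide_le_eq mult_ac)
    then show ?thesis by linarith
  qed
  then have "inner D D \<le> G * norm D"
    by (intro tendsto_upperbound[OF lim]) (auto simp: eventually_at_filter)
  then show ?thesis
    using False by (simp add: power2_norm_eq_inner[symmetric] power2_eq_square)
qed

text \<open>The squared distances to \<open>z\<close> telescope. The directions are arbitrary
  bounded vectors; convexity enters only when the inner products are bounded from below.\<close>

lemma sum_subgradient_steps_le:
  fixes w v :: "nat \<Rightarrow> 'a::real_inner"
  assumes step: "\<And>t. t \<ge> 1 \<Longrightarrow> w (t + 1) = w t - \<eta> *\<^sub>R v t"
    and bound: "\<And>t. t \<ge> 1 \<Longrightarrow> norm (v t) \<le> G"
  shows "2 * \<eta> * (\<Sum>t=1..T. inner (v t) (w t - z)) \<le> (norm (w 1 - z))\<^sup>2 + real T * \<eta>\<^sup>2 * G\<^sup>2"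
proof -
  \<comment> \<open>The last squared distance stays on the left so that the induction closes; it is
    dropped afterwards as nonnegative.\<close>
  have "2 * \<eta> * (\<Sum>t=1..T. inner (v t) (w t - z)) + (norm (w (T + 1) - z))\<^sup>2
      \<le> (norm (w 1 - z))\<^sup>2 + real T * \<eta>\<^sup>2 * G\<^sup>2"
  proof (induction T)
    case (Suc T)
    let ?u = "w (T + 1) - z" and ?v = "v (T + 1)"
    have "w (Suc T + 1) - z = ?u - \<eta> *\<^sub>R ?v"
      using step[of "Suc T"] by simp
    then have "(norm (w (Suc T + 1) - z))\<^sup>2
        = (norm ?u)\<^sup>2 - 2 * \<eta> * inner ?v ?u + \<eta>\<^sup>2 * (norm ?v)\<^sup>2"
      by (simp only: power2_norm_eq_inner)
        (simp add: inner_diff_left inner_diff_right inner_commute power2_eq_square algebra_simps)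
    moreover have "\<eta>\<^sup>2 * (norm ?v)\<^sup>2 \<le> \<eta>\<^sup>2 * G\<^sup>2"
      using bound[of "T + 1"] by (intro mult_left_mono power_mono) auto
    ultimately show ?case
      using Suc.IH by (simp add: algebra_simps)
  qed simp
  then show ?thesis
    using zero_le_power2[of "norm (w (T + 1) - z)"] by linarith
qed

section \<open>The soft switch and the direction it selects\<close>

lemma soft_switch_bounds: "0 \<le> soft_switch \<beta> x" "soft_switch \<beta> x \<le> 1"
  by (auto simp: soft_switch_def)

lemma soft_switch_eq_1: "soft_switch \<beta> x = 1" if "\<beta> > 0" "x \<ge> 0"
  using that by (simp add: soft_switch_def)

lemma soft_switch_less_1: "soft_switch \<beta> x < 1" if "\<beta> > 0" "x < 0"
  using that by (simp add: soft_switch_def mult_pos_neg)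

text \<open>With slope \<open>2 / \<epsilon>\<close> the ramp reaches zero exactly at
  \<open>y = \<epsilon> / 2\<close>, so both sides vanish wherever \<open>y\<close> is too small for
  a direct comparison.\<close>

lemma soft_switch_mult_ge:
  assumes "\<epsilon> > 0"
  shows "soft_switch (2 / \<epsilon>) (y - \<epsilon>) * (\<epsilon> / 2) \<le> soft_switch (2 / \<epsilon>) (y - \<epsilon>) * y"
proof (cases "y \<le> \<epsilon> / 2")
  case True
  then have "1 + 2 / \<epsilon> * (y - \<epsilon>) \<le> 0"
    using assms by (simp add: field_simps)
  then show ?thesis
    by (simp add: soft_switch_def)
next
  case False
  then show ?thesis
    by (intro mult_left_mono soft_switch_bounds) simp
qed

lemma norm_switching_direction_le:
  assumes "norm (gradient f x) \<le> G" "norm (gradient g x) \<le> G"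
  shows "norm (switching_direction \<beta> \<epsilon> f g x) \<le> G"
proof -
  define s where "s = soft_switch \<beta> (g x - \<epsilon>)"
  have s: "0 \<le> s" "s \<le> 1"
    by (simp_all add: s_def soft_switch_bounds)
  have "norm (switching_direction \<beta> \<epsilon> f g x)
      \<le> s * norm (gradient g x) + (1 - s) * norm (gradient f x)"
    unfolding switching_direction_def s_def[symmetric]
    using s by (intro norm_triangle_le) simp
  also have "\<dots> \<le> G"
    using s assms by (intro convex_bound_le) auto
  finally show ?thesis .
qed

text \<open>The gradient inequalities of \<open>g\<close> and \<open>f\<close> at \<open>x\<close>
  are combined with the same weights that form the direction.\<close>

lemma inner_switching_direction_ge:
  fixes \<beta> \<epsilon> :: real
  assumes f: "convex_on UNIV f" "GDERIV f x :> gradient f x"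
    and g: "convex_on UNIV g" "GDERIV g x :> gradient g x"
  defines "s \<equiv> soft_switch \<beta> (g x - \<epsilon>)"
  shows "s * (g x - g z) + (1 - s) * (f x - f z)
    \<le> inner (switching_direction \<beta> \<epsilon> f g x) (x - z)"
proof -
  have s: "0 \<le> s" "s \<le> 1"
    by (simp_all add: s_def soft_switch_bounds)
  have "g x - g z \<le> inner (gradient g x) (x - z)" "f x - f z \<le> inner (gradient f x) (x - z)"
    using convex_on_above_gradient[OF f, of z] convex_on_above_gradient[OF g, of z]
    by (simp_all add: inner_diff_left inner_diff_right inner_commute algebra_simps)
  then show ?thesis
    unfolding switching_direction_def s_def[symmetric] inner_add_left inner_scaleR_left
    using s by (intro add_mono mult_left_mono) auto
qed

section \<open>Convergence of the weighted average\<close>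

theorem theorem3:
  fixes f g :: "real ^ 'd \<Rightarrow> real"
    and w :: "nat \<Rightarrow> real ^ 'd"
    and wstar wbar :: "real ^ 'd"
    and T :: nat
    and G D \<epsilon> \<eta> \<beta> :: real
    and \<A> :: "nat set"
    and \<alpha> :: "nat \<Rightarrow> real"
  assumes "f differentiable_on UNIV" and "convex_on UNIV f" and "G-lipschitz_on UNIV f"
    and "g differentiable_on UNIV" and "convex_on UNIV g" and "G-lipschitz_on UNIV g"
    and "G > 0"
    and "is_arg_min f (\<lambda>x. g x \<le> 0) wstar"
    and "T \<ge> 1"
    and "D = norm (w 1 - wstar)"
    and "\<forall>t\<ge>1. w (t + 1) = w t - \<eta> *\<^sub>R switching_direction \<beta> \<epsilon> f g (w t)"
    and "\<A> = {t \<in> {1..T}. g (w t) < \<epsilon>}"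
    and "\<alpha> = (\<lambda>t. (1 - soft_switch \<beta> (g (w t) - \<epsilon>)) /
                 (\<Sum>s\<in>\<A>. 1 - soft_switch \<beta> (g (w s) - \<epsilon>)))"
    and "wbar = (\<Sum>t\<in>\<A>. \<alpha> t *\<^sub>R w t)"
    and "\<epsilon> > 0"
    and "\<epsilon> = 2 * D * G / sqrt (real T)"
    and "\<eta> = D / (G * sqrt (real T))"
    and "\<beta> = 2 / \<epsilon>"
  shows "\<A> \<noteq> {} \<and>
         (\<Sum>s\<in>\<A>. 1 - soft_switch \<beta> (g (w s) - \<epsilon>)) \<noteq> 0 \<and>
         f wbar - f wstar \<le> \<epsilon> \<and> g wbar \<le> \<epsilon>"
proof -
  note f = assms(1-3) and g = assms(4-6)
  define s where "s t = soft_switch \<beta> (g (w t) - \<epsilon>)" for t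
  define v where "v t = switching_direction \<beta> \<epsilon> f g (w t)" for t
  define S where "S = (\<Sum>t\<in>\<A>. 1 - s t)"
  have \<beta>: "\<beta> > 0"
    using \<open>\<beta> = 2 / \<epsilon>\<close> \<open>\<epsilon> > 0\<close> by simp
  have T: "sqrt (real T) > 0" "(sqrt (real T))\<^sup>2 = real T"
    using \<open>T \<ge> 1\<close> by auto
  \<comment> \<open>\<open>D = 0\<close> would force \<open>\<epsilon> = 0\<close>. Positivity of
    \<open>D\<close> makes the step size positive, so it can be cancelled below.\<close>
  have "D > 0"
    using \<open>\<epsilon> > 0\<close> assms(10,16) T by (cases "D = 0") auto
  then have \<eta>: "\<eta> > 0"
    using assms(17) \<open>G > 0\<close> T by simp
  have opt: "g wstar \<le> 0"
    using assms(8) by (simp add: is_arg_min_def)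
  have df: "GDERIV f x :> gradient f x" and dg: "GDERIV g x :> gradient g x" for x
    using f(1) g(1) by (auto intro!: GDERIV_gradient simp: differentiable_on_def)
  have s_bounds: "0 \<le> s t" "s t \<le> 1" for t
    by (simp_all add: s_def soft_switch_bounds)

  have "2 * \<eta> * (\<Sum>t=1..T. inner (v t) (w t - wstar)) \<le> D\<^sup>2 + real T * \<eta>\<^sup>2 * G\<^sup>2"
    unfolding assms(10)
  proof (rule sum_subgradient_steps_le)
    show "w (t + 1) = w t - \<eta> *\<^sub>R v t" if "t \<ge> 1" for t
      using assms(11) that by (simp add: v_def)
    show "norm (v t) \<le> G" for t
      unfolding v_def
      by (intro norm_switching_direction_le lipschitz_on_norm_gradient_le[OF f(3) df]
          lipschitz_on_norm_gradient_le[OF g(3) dg])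
  qed
  \<comment> \<open>The step size balances the two error terms: each equals the square of
    \<open>D\<close>, and \<open>\<eta> * \<epsilon> * real T\<close> is twice that square.\<close>
  also have "D\<^sup>2 + real T * \<eta>\<^sup>2 * G\<^sup>2 = 2 * \<eta> * (\<epsilon> / 2 * real T)"
  proof -
    define r where "r = sqrt (real T)"
    have "r > 0" "real T = r\<^sup>2" "\<epsilon> = 2 * D * G / r" "D = \<eta> * G * r"
      using T assms(16,17) \<open>G > 0\<close> by (simp_all add: r_def)
    then show ?thesis
      by (simp add: power2_eq_square)
  qed
  finally have upper: "(\<Sum>t=1..T. inner (v t) (w t - wstar)) \<le> \<epsilon> / 2 * real T"
    using \<eta> by simp

  have "s t * (\<epsilon> / 2) + (1 - s t) * (f (w t) - f wstar) \<le> inner (v t) (w t - wstar)" for t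
  proof -
    have "s t * (\<epsilon> / 2) \<le> s t * g (w t)"
      using soft_switch_mult_ge[OF \<open>\<epsilon> > 0\<close>] by (simp add: s_def \<open>\<beta> = 2 / \<epsilon>\<close>)
    \<comment> \<open>Feasibility of \<open>wstar\<close> means that subtracting
      \<open>g wstar\<close> cannot decrease the value.\<close>
    also have "\<dots> \<le> s t * (g (w t) - g wstar)"
      using opt s_bounds by (intro mult_left_mono) auto
    finally have "s t * (\<epsilon> / 2) + (1 - s t) * (f (w t) - f wstar)
        \<le> s t * (g (w t) - g wstar) + (1 - s t) * (f (w t) - f wstar)"
      by (rule add_right_mono)
    also have "\<dots> \<le> inner (v t) (w t - wstar)"
      unfolding v_def s_def by (rule inner_switching_direction_ge[OF f(2) df g(2) dg])
    finally show ?thesis .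
  qed
  then have "(\<Sum>t=1..T. s t * (\<epsilon> / 2) + (1 - s t) * (f (w t) - f wstar)) \<le> \<epsilon> / 2 * real T"
    by (intro order_trans[OF sum_mono upper])
  \<comment> \<open>Spreading the bound as \<open>\<epsilon> / 2\<close> per iterate merges it with
    the switch term: \<open>s t * (\<epsilon> / 2) - \<epsilon> / 2\<close> is
    \<open>- (1 - s t) * (\<epsilon> / 2)\<close>.\<close>
  moreover have "(\<Sum>t=1..T. (1 - s t) * (f (w t) - f wstar - \<epsilon> / 2))
      = (\<Sum>t=1..T. s t * (\<epsilon> / 2) + (1 - s t) * (f (w t) - f wstar) - \<epsilon> / 2)"
    by (intro sum.cong) (simp_all add: field_simps)
  ultimately have "(\<Sum>t=1..T. (1 - s t) * (f (w t) - f wstar - \<epsilon> / 2)) \<le> 0"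
    by (simp add: sum_subtractf mult.commute)
  \<comment> \<open>Outside \<open>\<A>\<close> the switch is saturated at 1, so those weights
    vanish.\<close>
  moreover have "(\<Sum>t=1..T. (1 - s t) * (f (w t) - f wstar - \<epsilon> / 2))
      = (\<Sum>t\<in>\<A>. (1 - s t) * (f (w t) - f wstar - \<epsilon> / 2))"
  proof (rule sum.mono_neutral_right)
    show "\<forall>t\<in>{1..T} - \<A>. (1 - s t) * (f (w t) - f wstar - \<epsilon> / 2) = 0"
    proof
      fix t
      assume "t \<in> {1..T} - \<A>"
      then have "g (w t) - \<epsilon> \<ge> 0"
        using assms(12) by auto
      then show "(1 - s t) * (f (w t) - f wstar - \<epsilon> / 2) = 0"
        by (simp add: s_def soft_switch_eq_1[OF \<beta>])
    qed
  qed (use assms(12) in auto)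
  ultimately have weighted: "(\<Sum>t\<in>\<A>. (1 - s t) * (f (w t) - f wstar - \<epsilon> / 2)) \<le> 0"
    by simp

  \<comment> \<open>Otherwise every step would follow \<open>gradient g\<close> alone and every
    inner product would be at least \<open>\<epsilon>\<close>, giving twice the upper bound on their
    sum.\<close>
  have "\<A> \<noteq> {}"
  proof
    assume "\<A> = {}"
    then have far: "g (w t) \<ge> \<epsilon>" if "t \<in> {1..T}" for t
      using that assms(12) by force
    have "\<epsilon> \<le> inner (v t) (w t - wstar)" if "t \<in> {1..T}" for t
      using inner_switching_direction_ge[OF f(2) df g(2) dg, of \<beta> "w t" \<epsilon> wstar]
        soft_switch_eq_1[OF \<beta>, of "g (w t) - \<epsilon>"] far[OF that] opt
      unfolding v_def by simp
    then have "(\<Sum>t=1..T. \<epsilon>) \<le> (\<Sum>t=1..T. inner (v t) (w t - wstar))"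
      by (intro sum_mono)
    with upper have "\<epsilon> * real T \<le> \<epsilon> / 2 * real T"
      by (simp add: mult.commute)
    then show False
      using \<open>\<epsilon> > 0\<close> \<open>T \<ge> 1\<close> by simp
  qed
  have fin: "finite \<A>"
    by (simp add: assms(12))
  \<comment> \<open>The strict inequality defining \<open>\<A>\<close> keeps each weight positive,
    hence also the normalising sum \<open>S\<close>.\<close>
  have pos: "1 - s t > 0" if "t \<in> \<A>" for t
    using that soft_switch_less_1[OF \<beta>, of "g (w t) - \<epsilon>"] by (simp add: s_def assms(12))
  have S: "S > 0"
    unfolding S_def using fin \<open>\<A> \<noteq> {}\<close> pos by (rule sum_pos)
  have \<alpha>: "\<alpha> t = (1 - s t) / S" for t
    by (simp add: assms(13) s_def S_def)
  have \<alpha>_nonneg: "\<alpha> t \<ge> 0" for t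
    using S s_bounds by (simp add: \<alpha>)
  have \<alpha>_sum: "(\<Sum>t\<in>\<A>. \<alpha> t) = 1"
    using S by (simp add: \<alpha> S_def flip: sum_divide_distrib)

  \<comment> \<open>Jensen, followed by the weighted bound divided by \<open>S\<close>; this yields
    the gap \<open>\<epsilon> / 2\<close>, which is then relaxed to
    \<open>\<epsilon>\<close>.\<close>
  have "f wbar - f wstar - \<epsilon> / 2 \<le> (\<Sum>t\<in>\<A>. \<alpha> t * f (w t)) - f wstar - \<epsilon> / 2"
    using convex_on_sum[OF fin \<open>\<A> \<noteq> {}\<close> f(2) \<alpha>_sum \<alpha>_nonneg, of w] by (simp add: assms(14))
  also have "\<dots> = (\<Sum>t\<in>\<A>. \<alpha> t * (f (w t) - f wstar - \<epsilon> / 2))"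
    using \<alpha>_sum by (simp add: right_diff_distrib sum_subtractf sum_distrib_right[symmetric]
        sum_divide_distrib[symmetric])
  also have "\<dots> = (\<Sum>t\<in>\<A>. (1 - s t) * (f (w t) - f wstar - \<epsilon> / 2)) / S"
    by (simp add: \<alpha> sum_divide_distrib)
  also have "\<dots> \<le> 0"
    using weighted S by (simp add: divide_nonpos_pos)
  finally have "f wbar - f wstar \<le> \<epsilon>"
    using \<open>\<epsilon> > 0\<close> by simp
  moreover have "g wbar \<le> \<epsilon>"
  proof -
    have "g wbar \<le> (\<Sum>t\<in>\<A>. \<alpha> t * g (w t))"
      using convex_on_sum[OF fin \<open>\<A> \<noteq> {}\<close> g(2) \<alpha>_sum \<alpha>_nonneg, of w] by (simp add: assms(14))
    also have "\<dots> \<le> (\<Sum>t\<in>\<A>. \<alpha> t * \<epsilon>)"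
      using \<alpha>_nonneg by (intro sum_mono mult_left_mono) (auto simp: assms(12))
    also have "\<dots> = \<epsilon>"
      using \<alpha>_sum by (simp flip: sum_distrib_right)
    finally show ?thesis .
  qed
  ultimately show ?thesis
    using \<open>\<A> \<noteq> {}\<close> S by (simp add: S_def s_def)
qed

end
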